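(* Let $L(x,y,z)$ and $R(x,y,z)$ be the three-strand tangle diagrams, $\widehat\Phi_a,\widehat\Phi_b$ the crossing-change morphisms, $\mathrm{R}_{\mathsf O\pm},\mathrm{R}_{\mathsf U\pm}$ the Reidemeister III morphisms and $\psi_{\mathsf O},\psi_{\mathsf U}$ the degree $-1$ morphisms described in the context. Then the following hold. (1) The following two hexagons commute strictly (i.e. as equalities of morphisms, not merely up to homotopy): $$\widehat\Phi_a\circ \mathrm{R}_{\mathsf O-}\circ\widehat\Phi_a=\widehat\Phi_b\circ \mathrm{R}_{\mathsf U-}\circ\widehat\Phi_b:\ [\![L(-,-,-)]\!]\to[\![R(+,+,-)]\!],$$ where the left side is $[\![L(-,-,-)]\!]\xrightarrow{\widehat\Phi_a}[\![L(+,-,-)]\!]\xrightarrow{\mathrm{R}_{\mathsf O-}}[\![R(-,+,-)]\!]\xrightarrow{\widehat\Phi_a}[\![R(+,+,-)]\!]$ and the right side is $[\![L(-,-,-)]\!]\xrightarrow{\widehat\Phi_b}[\![L(-,+,-)]\!]\xrightarrow{\mathrm{R}_{\mathsf U-}}[\![R(+,-,-)]\!]\xrightarrow{\widehat\Phi_b}[\![R(+,+,-)]\!]$; and $$\widehat\Phi_a\circ \mathrm{R}_{\mathsf O+}\circ\widehat\Phi_a=\widehat\Phi_b\circ \mathrm{R}_{\mathsf U+}\circ\widehat\Phi_b:\ [\![L(-,-,+)]\!]\to[\![R(+,+,+)]\!],$$ where the left side is $[\![L(-,-,+)]\!]\xrightarrow{\widehat\Phi_a}[\![L(+,-,+)]\!]\xrightarrow{\mathrm{R}_{\mathsf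 O+}}[\![R(-,+,+)]\!]\xrightarrow{\widehat\Phi_a}[\![R(+,+,+)]\!]$ and the right side is $[\![L(-,-,+)]\!]\xrightarrow{\widehat\Phi_b}[\![L(-,+,+)]\!]\xrightarrow{\mathrm{R}_{\mathsf U+}}[\![R(+,-,+)]\!]\xrightarrow{\widehat\Phi_b}[\![R(+,+,+)]\!]$. (2) In the module of morphisms of degree $-1$ from $[\![L(-,-,-)]\!]$ to $[\![R(+,+,+)]\!]$, $$\widehat\Phi_a\,\psi_{\mathsf O}\,\widehat\Phi_a-\widehat\Phi_b\,\psi_{\mathsf U}\,\widehat\Phi_b=0,$$ where the first term is $[\![L(-,-,-)]\!]\xrightarrow{\widehat\Phi_a}[\![L(+,-,-)]\!]\xrightarrow{\psi_{\mathsf O}}[\![R(-,+,+)]\!]\xrightarrow{\widehat\Phi_a}[\![R(+,+,+)]\!]$ and the second is $[\![L(-,-,-)]\!]\xrightarrow{\widehat\Phi_b}[\![L(-,+,-)]\!]\xrightarrow{\psi_{\mathsf U}}[\![R(+,-,+)]\!]\xrightarrow{\widehat\Phi_b}[\![R(+,+,+)]\!]$.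
   Context: **Category.** $\mathrm{Cob}$ is Bar-Natan's category: the additive closure of the category whose objects are crossingless tangles in a disc (with fixed endpoints) and whose morphisms are formal $\mathbb Z$-linear combinations of $2$-dimensional cobordisms with corners, up to boundary-preserving isotopy, modulo the relations: ($S$) a sphere component is $0$; ($T$) a torus component is $2$; ($4Tu$) for a surface with four disjoint discs $D_1,\dots,D_4$ removed, $C_{12}+C_{34}=C_{13}+C_{24}$, where $C_{ij}$ is obtained by joining $\partial D_i,\partial D_j$ by a tube and capping off the other two boundary circles with discs. Quantum grading shifts are suppressed. **Crossings.** Strands are oriented upward. A crossing is positive ($+$) if the over-strand runs from lower left to upper right, negative ($-$) if the over-strand runs from lower right to upper left. $V$ is the vertical smoothing (two vertical arcs), $H$ the horizontal smoothing (an arc joining the two bottom endpoints and an arc joining the two top endpoints). $\delta_-:H\to V$ and $\delta_+:V\to H$ are the single-saddle cobordisms. The complex $[\![-]\!]$ of a negative crossing is $H\xrightarrow{\delta_-}V$ in degrees $-1,0$; that of a positive crossing is $V\xrightarrow{-\delta_+}H$ in degrees $0,1$. For a general tangle diagram $D$, $[\![D]\!]$ is the complex in $\mathrm{Cob}$ obtained by stacking up (planar tensor product of) the complexes of its crossings; its direct summands are the states of $D$ (a choice of $V$ or $H$ at every crossing). **Crossing change.** $\Phi:V\to V$ is $\Phi=\Phi'-\Phi''$, where $\Phi'$ is the identity cobordism with a tube joining its two sheets ($\Phi'=\delta_-\delta_+$) and $\Phi''$ is the identity cobordism with a handle added to its left sheet. $\widehat\Phi:[\![-]\!]\to[\![+]\!]$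 (negative crossing to positive crossing) is $\Phi$ on $V$ in degree $0$ and zero in the other degrees. If $x$ is a crossing of a diagram, $\widehat\Phi_x$ denotes $\widehat\Phi$ applied at $x$ (identity at all other crossings); it is nonzero only on states with $x$ smoothed as $V$, and takes values in states with $x$ smoothed as $V$. **Diagrams.** All diagrams have three upward strands with bottom endpoints $b_1,b_2,b_3$ and top endpoints $t_1,t_2,t_3$ (left to right), strands running $b_1\to t_3$, $b_2\to t_2$, $b_3\to t_1$. In $L(x,y,z)$ the crossings from bottom to top are: $b$ (between positions 1,2), $c$ (between positions 2,3), $a$ (between positions 1,2). In $R(x,y,z)$ the crossings from bottom to top are: $b$ (positions 2,3), $c$ (positions 1,2), $a$ (positions 2,3). The entries $x,y,z$ describe $a,b,c$ respectively; each is a sign $\pm$ or a smoothing $V,H$. A state is denoted by the triple of smoothings of $(a,b,c)$. **States.** Let $1$ be three vertical strands; $e_1$ have arcs $b_1b_2,\ t_1t_2,\ b_3t_3$; $e_2$ have arcs $b_2b_3,\ t_2t_3,\ b_1t_1$; $P$ have arcs $b_1b_2,\ b_3t_1,\ t_2t_3$; $Q$ have arcs $b_2b_3,\ b_1t_3,\ t_1t_2$; $\bigcirc$ a closed circle (lying between the two turn-backs). Up to planar isotopy the states are: for $L$: $VVV=1$, $VVH=e_2$, $VHV=HVV=e_1$, $HHV=e_1\cup\bigcirc$, $VHH=P$, $HVH=Q$, $HHH=e_1$; for $R$: $VVV=1$, $VVH=e_1$, $VHV=HVV=e_2$, $HHV=e_2\cup\bigcirc$, $HVH=P$, $VHH=Q$,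 $HHH=e_2$. **Elementary cobordisms.** $s_i:1\to e_i$ and $s_i^*:e_i\to1$ are the single saddles; $\eta_2:e_2\to e_2\cup\bigcirc$ is birth of the circle; $\varepsilon_1:e_1\cup\bigcirc\to e_1$ is death of the circle; $\sigma_{X,Y}:X\to Y$ is the single saddle for $(X,Y)\in\{(Q,e_2),(P,e_2),(e_1,P),(e_1,Q)\}$. $\mathrm{id}$ denotes the identity (isotopy) cobordism between two states that are isotopic to each other. **Building blocks.** The following are families of morphisms, with all components not listed equal to $0$. Source and target states $abc$ are states of the $L$-diagram and of the $R$-diagram respectively. *O-case* (source $L(+,-,\cdot)$, target $R(-,+,\cdot)$). $\omega_{\mathsf O}:[\![L(+,-,V)]\!]\to[\![R(-,+,V)]\!]$, degree $0$: in degree $0$, on $VVV\oplus HHV\to VVV\oplus HHV$, $\omega_{\mathsf O}^0=\mathrm{id}_1+\eta_2s_2+s_1^*\varepsilon_1+\eta_2s_2s_1^*\varepsilon_1$. $\gamma_{\mathsf O}:[\![L(+,-,H)]\!]\to[\![R(-,+,H)]\!]$, degree $0$: $\gamma_{\mathsf O}^{-1}=-\mathrm{id}:VHH=P\to HVH=P$; $\gamma_{\mathsf O}^0$ has components $-\mathrm{id}:VVH=e_2\to HHH=e_2$ and $+\mathrm{id}:HHH=e_1\to VVH=e_1$; $\gamma_{\mathsf O}^1=+\mathrm{id}:HVH=Q\to VHH=Q$. $F_{\mathsf O-}:[\![L(+,-,H)]\!]\to[\![R(-,+,V)]\!]$, degree $-1$: $F_{\mathsf O-}^0=\mathrm{id}:VVH=e_2\to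 HVV=e_2$; $F_{\mathsf O-}^1=\eta_2\sigma_{Q,e_2}:HVH=Q\to HHV=e_2\cup\bigcirc$. $F_{\mathsf O+}:[\![L(+,-,V)]\!]\to[\![R(-,+,H)]\!]$, degree $-1$: $F_{\mathsf O+}^0=\sigma_{e_1,P}\varepsilon_1:HHV=e_1\cup\bigcirc\to HVH=P$; $F_{\mathsf O+}^1=\mathrm{id}:HVV=e_1\to VVH=e_1$. $G_{\mathsf O}:[\![L(+,-,V)]\!]\to[\![R(-,+,V)]\!]$, degree $-1$: $G_{\mathsf O}^0=-s_2-s_2s_1^*\varepsilon_1:VVV\oplus HHV\to HVV=e_2$; $G_{\mathsf O}^1=s_1^*+\eta_2s_2s_1^*:HVV=e_1\to VVV\oplus HHV$. $\Psi_{\mathsf O-}:[\![L(+,-,H)]\!]\to[\![R(-,+,V)]\!]$, degree $-2$: $\Psi_{\mathsf O-}^1=-\sigma_{Q,e_2}:HVH=Q\to HVV=e_2$. $\Psi_{\mathsf O+}:[\![L(+,-,V)]\!]\to[\![R(-,+,H)]\!]$, degree $-2$: $\Psi_{\mathsf O+}^1=-\sigma_{e_1,P}:HVV=e_1\to HVH=P$. *U-case* (source $L(-,+,\cdot)$, target $R(+,-,\cdot)$). $\omega_{\mathsf U}:[\![L(-,+,V)]\!]\to[\![R(+,-,V)]\!]$, degree $0$: in degree $0$, on $VVV\oplus HHV\to VVV\oplus HHV$, $\omega_{\mathsf U}^0=\mathrm{id}_1-\eta_2s_2-s_1^*\varepsilon_1+\eta_2s_2s_1^*\varepsilon_1$.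 $\gamma_{\mathsf U}:[\![L(-,+,H)]\!]\to[\![R(+,-,H)]\!]$, degree $0$: $\gamma_{\mathsf U}^{-1}=+\mathrm{id}:HVH=Q\to VHH=Q$; $\gamma_{\mathsf U}^0$ has components $-\mathrm{id}:VVH=e_2\to HHH=e_2$ and $+\mathrm{id}:HHH=e_1\to VVH=e_1$; $\gamma_{\mathsf U}^1=-\mathrm{id}:VHH=P\to HVH=P$. $F_{\mathsf U-}:[\![L(-,+,H)]\!]\to[\![R(+,-,V)]\!]$, degree $-1$: $F_{\mathsf U-}^0=\mathrm{id}:VVH=e_2\to VHV=e_2$; $F_{\mathsf U-}^1=-\eta_2\sigma_{P,e_2}:VHH=P\to HHV=e_2\cup\bigcirc$. $F_{\mathsf U+}:[\![L(-,+,V)]\!]\to[\![R(+,-,H)]\!]$, degree $-1$: $F_{\mathsf U+}^0=-\sigma_{e_1,Q}\varepsilon_1:HHV=e_1\cup\bigcirc\to VHH=Q$; $F_{\mathsf U+}^1=\mathrm{id}:VHV=e_1\to VVH=e_1$. $G_{\mathsf U}:[\![L(-,+,V)]\!]\to[\![R(+,-,V)]\!]$, degree $-1$: $G_{\mathsf U}^0=-s_2+s_2s_1^*\varepsilon_1:VVV\oplus HHV\to VHV=e_2$; $G_{\mathsf U}^1=s_1^*-\eta_2s_2s_1^*:VHV=e_1\to VVV\oplus HHV$. $\Psi_{\mathsf U-}:[\![L(-,+,H)]\!]\to[\![R(+,-,V)]\!]$, degree $-2$: $\Psi_{\mathsf U-}^1=-\sigma_{P,e_2}:VHH=P\to VHV=e_2$.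 $\Psi_{\mathsf U+}:[\![L(-,+,V)]\!]\to[\![R(+,-,H)]\!]$, degree $-2$: $\Psi_{\mathsf U+}^1=-\sigma_{e_1,Q}:VHV=e_1\to VHH=Q$. **Assembled morphisms.** For $X\in\{L,R\}$ and signs $x,y$ decompose with respect to the crossing $c$: $[\![X(x,y,-)]\!]^i=[\![X(x,y,V)]\!]^i\oplus[\![X(x,y,H)]\!]^{i+1}$ and $[\![X(x,y,+)]\!]^i=[\![X(x,y,H)]\!]^{i-1}\oplus[\![X(x,y,V)]\!]^i$ (summands in this order). For $\ast\in\{\mathsf O,\mathsf U\}$ define $$\mathrm{R}_{\ast-}=\begin{bmatrix}-\omega_\ast & -F_{\ast-} \\ 0 & \gamma_\ast\end{bmatrix},\qquad \mathrm{R}_{\ast+}=\begin{bmatrix}\gamma_\ast & -F_{\ast+} \\ 0 & \omega_\ast\end{bmatrix},\qquad \psi_\ast=\begin{bmatrix}-\Psi_{\ast+} & 0 \\ G_\ast & -\Psi_{\ast-}\end{bmatrix},$$ so that $\mathrm{R}_{\mathsf O\pm}:[\![L(+,-,\pm)]\!]\to[\![R(-,+,\pm)]\!]$, $\mathrm{R}_{\mathsf U\pm}:[\![L(-,+,\pm)]\!]\to[\![R(+,-,\pm)]\!]$ have degree $0$, and $\psi_{\mathsf O}:[\![L(+,-,-)]\!]\to[\![R(-,+,+)]\!]$, $\psi_{\mathsf U}:[\![L(-,+,-)]\!]\to[\![R(+,-,+)]\!]$ have degree $-1$. Here $\mathrm{R}_{\mathsf O\pm}$ (resp. $\mathrm{R}_{\mathsf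 U\pm}$) is the morphism of the Reidemeister III move in which the middle strand $b_2\to t_2$ passes over (resp. under) the other two strands. All equalities in the claim are equalities of morphisms in every homological degree. *)

theory Defs
  imports "HOL-Analysis.Analysis" "HOL-Library.Poly_Mapping"
begin

section \<open>Bar-Natan's category for three strands\<close>

text \<open>
  Tangles and cobordisms are locally flat subsets of a rectangle (the disc) and of the
  cylinder over it; isotopies are topological ambient isotopies fixing the boundary of the
  cylinder pointwise. The last coordinate of the cylinder is time.
\<close>

type_synonym plane = "real \<times> real"
type_synonym space = "real \<times> real \<times> real"
type_synonym tangle = "plane set"
type_synonym surface = "space set"

text \<open>Chains are formal integral combinations of surfaces.\<close>

type_synonym chain = "surface \<Rightarrow>\<^sub>0 int"

definition disc :: "plane set" where
  "disc = {0..4} \<times> {0..7}"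

definition cylinder :: "space set" where
  "cylinder = {0..4} \<times> {0..7} \<times> {0..1}"

definition endpoints :: "plane set" where
  "endpoints = {1, 2, 3} \<times> {0, 7}"

definition crossingless_tangle :: "tangle \<Rightarrow> bool" where
  "crossingless_tangle T \<longleftrightarrow>
     closed T \<and> T \<subseteq> disc \<and> T \<inter> frontier disc = endpoints \<and>
     (\<forall>p\<in>T. \<exists>U W f g. p \<in> U \<and> openin (top_of_set disc) U \<and>
        openin (top_of_set {(u, v). 0 \<le> v}) (W :: plane set) \<and> homeomorphism U W f g \<and>
        f ` (U \<inter> T) = W \<inter> {(u, v). u = 0})"

definition at_time :: "real \<Rightarrow> tangle \<Rightarrow> surface" where
  "at_time t T = {(x, y, z). (x, y) \<in> T \<and> z = t}"

definition product_surface :: "tangle \<Rightarrow> surface" where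
  "product_surface T = {(x, y, z). (x, y) \<in> T \<and> 0 \<le> z \<and> z \<le> 1}"

text \<open>
  The local model is the half-plane or quadrant \<open>u = 0\<close> in \<open>{(u, v, w). 0 \<le> v, 0 \<le> w}\<close>; charts
  may land anywhere in the model, so it covers interior, boundary and corner points.
\<close>

definition flat_at :: "surface \<Rightarrow> space \<Rightarrow> bool" where
  "flat_at S p \<longleftrightarrow> (\<exists>U W f g. p \<in> U \<and> openin (top_of_set cylinder) U \<and>
     openin (top_of_set {(u, v, w). 0 \<le> v \<and> 0 \<le> w}) (W :: space set) \<and>
     homeomorphism U W f g \<and> f ` (U \<inter> S) = W \<inter> {(u, v, w). u = 0})"

definition cobordisms :: "tangle \<Rightarrow> tangle \<Rightarrow> surface set" where
  "cobordisms T0 T1 = {S. crossingless_tangle T0 \<and> crossingless_tangle T1 \<and>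
     closed S \<and> S \<subseteq> cylinder \<and>
     S \<inter> frontier cylinder = at_time 0 T0 \<union> at_time 1 T1 \<union> product_surface endpoints \<and>
     (\<forall>p\<in>S. flat_at S p)}"

definition ambient_isotopy :: "'a::topological_space set \<Rightarrow> (real \<Rightarrow> 'a \<Rightarrow> 'a) \<Rightarrow> bool" where
  "ambient_isotopy M h \<longleftrightarrow>
     continuous_on ({0..1} \<times> M) (\<lambda>(t, p). h t p) \<and>
     (\<forall>t\<in>{0..1}. (\<exists>g. homeomorphism M M (h t) g) \<and> (\<forall>p\<in>frontier M. h t p = p)) \<and>
     (\<forall>p\<in>M. h 0 p = p)"

definition isotopic :: "surface \<Rightarrow> surface \<Rightarrow> bool" where
  "isotopic S S' \<longleftrightarrow> S \<subseteq> cylinder \<and> (\<exists>h. ambient_isotopy cylinder h \<and> h 1 ` S = S')"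

subsection \<open>The relations\<close>

text \<open>
  The model of the (4Tu) relation is a box over the plane of the last two coordinates. In it,
  four discs (the lateral and top faces of the pillars over four squares) are replaced by the
  wall of an arch over two of the squares together with the discs over the other two.
\<close>

definition foot :: "nat \<Rightarrow> plane set" where
  "foot i = (if i = 1 then {0..1} \<times> {0..1} else if i = 2 then {2..3} \<times> {0..1}
             else if i = 3 then {0..1} \<times> {2..3} else {2..3} \<times> {2..3})"

definition wall :: "space set \<Rightarrow> space set" where
  "wall K = closure (frontier K \<inter> {p. 0 < fst p})"

definition cap :: "nat \<Rightarrow> space set" where
  "cap i = wall ({0..1} \<times> foot i)"

definition tube :: "nat \<Rightarrow> nat \<Rightarrow> space set" where
  "tube i j = wall ({0..2} \<times> (foot i \<union> foot j) \<union> {1..2} \<times> (convex hull (foot i \<union> foot j)))"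

definition four_ball :: "space set" where
  "four_ball = {0..3} \<times> {-1..4} \<times> {-1..4}"

definition four_tube :: "(space \<Rightarrow> space) \<Rightarrow> surface \<Rightarrow> nat \<Rightarrow> nat \<Rightarrow> surface" where
  "four_tube f S i j =
     (S - f ` four_ball) \<union> f ` (tube i j \<union> (\<Union>k\<in>{1, 2, 3, 4} - {i, j}. cap k))"

lemma isotopic_cobordisms:
  assumes "isotopic S S'" and S: "S \<in> cobordisms T0 T1"
  shows "S' \<in> cobordisms T0 T1"
proof -
  obtain h where h: "ambient_isotopy cylinder h" "h 1 ` S = S'"
    using assms by (auto simp: isotopic_def)
  define k where "k = h 1"
  obtain k' where k': "homeomorphism cylinder cylinder k k'"
    and fix_frontier: "\<And>p. p \<in> frontier cylinder \<Longrightarrow> k p = p"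
  proof -
    have "(1::real) \<in> {0..1}" by simp
    with h(1) show ?thesis using that unfolding ambient_isotopy_def k_def by blast
  qed
  have S': "S' = k ` S" using h(2) by (simp add: k_def)
  have compact: "compact cylinder"
    by (simp add: cylinder_def compact_Times)
  have sub: "S \<subseteq> cylinder" and clo: "closed S" using S by (auto simp: cobordisms_def)
  have "compact S"
    using compact_Int_closed[OF compact clo] sub by (simp add: Int_absorb1)
  moreover have contk: "continuous_on S k"
    using k' sub by (meson continuous_on_subset homeomorphism_cont1)
  ultimately have "closed S'" by (simp add: S' compact_continuous_image compact_imp_closed)
  moreover have "S' \<subseteq> cylinder"
    unfolding S' using image_mono[OF sub, of k] homeomorphism_image1[OF k'] by simp
  moreover have "S' \<inter> frontier cylinder = S \<inter> frontier cylinder"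
  proof -
    have fr: "frontier cylinder \<subseteq> cylinder"
      using compact by (simp add: compact_imp_closed frontier_subset_closed)
    have inj: "inj_on k cylinder"
      by (rule inj_on_inverseI[of _ k']) (use k' in \<open>simp add: homeomorphism_apply1\<close>)
    show ?thesis
    proof (intro equalityI subsetI)
      fix p assume p: "p \<in> S' \<inter> frontier cylinder"
      then obtain q where q: "q \<in> S" "p = k q" by (auto simp: S')
      have "k q = k p" using p q fix_frontier by simp
      then have "q = p" by (rule inj_onD[OF inj]) (use q p sub fr in auto)
      then show "p \<in> S \<inter> frontier cylinder" using p q by simp
    next
      fix p assume "p \<in> S \<inter> frontier cylinder"
      then show "p \<in> S' \<inter> frontier cylinder"
        using fix_frontier[of p] by (auto simp: S' image_iff intro!: bexI[of _ p])
    qed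
  qed
  moreover have "flat_at S' p" if p: "p \<in> S'" for p
  proof -
    obtain q where q: "q \<in> S" "p = k q" using p by (auto simp: S')
    then obtain U W f g where U: "q \<in> U" "openin (top_of_set cylinder) U"
      and W: "openin (top_of_set {(u, v, w). 0 \<le> v \<and> 0 \<le> w}) (W :: space set)"
      and fg: "homeomorphism U W f g" and im: "f ` (U \<inter> S) = W \<inter> {(u, v, w). u = 0}"
      using S unfolding cobordisms_def flat_at_def by blast
    have Usub: "U \<subseteq> cylinder" using U(2) openin_imp_subset by blast
    have opn: "openin (top_of_set cylinder) (k ` U)"
      using homeomorphism_imp_open_map[OF k' U(2)] .
    have kUsub: "k ` U \<subseteq> cylinder"
      using image_mono[OF Usub, of k] homeomorphism_image1[OF k'] by simp
    have kU: "homeomorphism (k ` U) U k' k"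
      by (rule homeomorphism_symD, rule homeomorphism_of_subsets[OF k' Usub kUsub refl])
    have hom: "homeomorphism (k ` U) W (f \<circ> k') (k \<circ> g)"
      by (rule homeomorphism_compose[OF kU fg])
    have kk: "k' (k x) = x" if "x \<in> cylinder" for x
      using k' that by (simp add: homeomorphism_apply1)
    have "k ` U \<inter> S' = k ` (U \<inter> S)"
    proof (intro equalityI subsetI)
      fix y assume "y \<in> k ` U \<inter> S'"
      then obtain a b where a: "a \<in> U" "y = k a" and b: "b \<in> S" "y = k b"
        unfolding S' by blast
      have "a = k' (k a)" "b = k' (k b)"
        using kk[of a] kk[of b] a b Usub sub by auto
      then have "a = b" using a b by simp
      then show "y \<in> k ` (U \<inter> S)" using a b by blast
    qed (auto simp: S')
    moreover have "(f \<circ> k') ` k ` (U \<inter> S) = f ` (U \<inter> S)"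
      unfolding image_image using kk Usub by (intro image_cong) auto
    ultimately have "(f \<circ> k') ` (k ` U \<inter> S') = W \<inter> {(u, v, w). u = 0}"
      using im by simp
    moreover have "p \<in> k ` U" using U(1) q by blast
    ultimately show ?thesis unfolding flat_at_def using opn W hom by blast
  qed
  ultimately show ?thesis
    using S by (simp add: cobordisms_def)
qed

text \<open>
  By the preceding lemma, the first clause needs no restriction to cobordisms: on combinations
  of cobordisms it imposes nothing but the identification of isotopic ones.
\<close>

inductive_set relations :: "tangle \<Rightarrow> tangle \<Rightarrow> chain set" for T0 T1 :: tangle where
  isotopy: "isotopic S S' \<Longrightarrow> frag_of S - frag_of S' \<in> relations T0 T1"
| S: "S \<in> cobordisms T0 T1 \<Longrightarrow> K \<in> components S \<Longrightarrow> K homeomorphic sphere (0::space) 1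
      \<Longrightarrow> frag_of S \<in> relations T0 T1"
| T: "S \<in> cobordisms T0 T1 \<Longrightarrow> K \<in> components S
      \<Longrightarrow> K homeomorphic (sphere (0::plane) 1 \<times> sphere (0::plane) 1)
      \<Longrightarrow> frag_of S - frag_cmul 2 (frag_of (S - K)) \<in> relations T0 T1"
| four_Tu: "S \<in> cobordisms T0 T1 \<Longrightarrow> homeomorphism four_ball (f ` four_ball) f g
      \<Longrightarrow> f ` four_ball \<subseteq> interior cylinder
      \<Longrightarrow> S \<inter> f ` four_ball = f ` (\<Union>k\<in>{1, 2, 3, 4}. cap k)
      \<Longrightarrow> frag_of (four_tube f S 1 2) + frag_of (four_tube f S 3 4)
            - frag_of (four_tube f S 1 3) - frag_of (four_tube f S 2 4) \<in> relations T0 T1"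
| zero: "0 \<in> relations T0 T1"
| diff: "c \<in> relations T0 T1 \<Longrightarrow> d \<in> relations T0 T1 \<Longrightarrow> c - d \<in> relations T0 T1"

text \<open>The morphism of the category represented by a chain, as a coset.\<close>

definition cob_class :: "tangle \<Rightarrow> tangle \<Rightarrow> chain \<Rightarrow> chain set" where
  "cob_class T0 T1 c = {d. d - c \<in> relations T0 T1}"

subsection \<open>Composition and isotopy cobordisms\<close>

definition stack :: "surface \<Rightarrow> surface \<Rightarrow> surface" where
  "stack S S' = {(x, y, z). 0 \<le> z \<and> z \<le> 1/2 \<and> (x, y, 2 * z) \<in> S} \<union>
                {(x, y, z). 1/2 \<le> z \<and> z \<le> 1 \<and> (x, y, 2 * z - 1) \<in> S'}"

definition chain_comp :: "chain \<Rightarrow> chain \<Rightarrow> chain" (infixr \<open>\<odot>\<close> 70) where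
  "g \<odot> f = frag_extend (\<lambda>S'. frag_extend (\<lambda>S. frag_of (stack S S')) f) g"

text \<open>
  The trace of a planar isotopy rel boundary; the constant isotopy is used when source and
  target coincide.
\<close>

definition isotopy_cobordism :: "tangle \<Rightarrow> tangle \<Rightarrow> surface" where
  "isotopy_cobordism T T' =
     (if T = T' then product_surface T
      else SOME S. \<exists>h. ambient_isotopy disc h \<and> h 1 ` T = T' \<and>
             S = {(x, y, z). 0 \<le> z \<and> z \<le> 1 \<and> (x, y) \<in> h z ` T})"

definition iso :: "tangle \<Rightarrow> tangle \<Rightarrow> chain" where
  "iso T T' = frag_of (isotopy_cobordism T T')"

text \<open>
  Morphisms between concrete tangles (source, target, chain), composed and transported along
  isotopy cobordisms when the tangles agree only up to planar isotopy.
\<close>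

type_synonym arrow = "tangle \<times> tangle \<times> chain"

fun arrow_comp :: "arrow \<Rightarrow> arrow \<Rightarrow> arrow" (infixr \<open>\<cdot>\<close> 70) where
  "(U0, U1, g) \<cdot> (T0, T1, f) = (T0, U1, g \<odot> iso T1 U0 \<odot> f)"

fun transport :: "arrow \<Rightarrow> tangle \<Rightarrow> tangle \<Rightarrow> chain" where
  "transport (T0, T1, f) T T' = iso T1 T' \<odot> f \<odot> iso T T0"


section \<open>Crossings\<close>

datatype smoothing = V | H
datatype crossing_entry = Pos | Neg | Smooth smoothing
datatype crossing = Ca | Cb | Cc
datatype side = L | R

type_synonym state = "crossing \<Rightarrow> smoothing"
type_synonym diagram = "side \<times> (crossing \<Rightarrow> crossing_entry)"

definition triple :: "'e \<Rightarrow> 'e \<Rightarrow> 'e \<Rightarrow> crossing \<Rightarrow> 'e" where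
  "triple x y z = (\<lambda>k. case k of Ca \<Rightarrow> x | Cb \<Rightarrow> y | Cc \<Rightarrow> z)"

definition diagram :: "side \<Rightarrow> crossing_entry \<Rightarrow> crossing_entry \<Rightarrow> crossing_entry \<Rightarrow> diagram" where
  "diagram X x y z = (X, triple x y z)"

subsection \<open>Local pictures\<close>

text \<open>
  A crossing lives in the box below; its strands enter and leave at first coordinates 0 and 1.
\<close>

definition local_box :: "plane set" where
  "local_box = {-1/4..5/4} \<times> {-1/4..5/4}"

fun arcs :: "smoothing \<Rightarrow> plane set" where
  "arcs V = {0, 1} \<times> {-1/4..5/4}"
| "arcs H = {0..1} \<times> {0, 1} \<union> {0, 1} \<times> ({-1/4..0} \<union> {1..5/4})"

text \<open>
  The saddle is swept out by the pencil of curves \<open>(1 - z) x (1 - x) = z y (1 - y)\<close> through the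
  four corners of the unit square, from the vertical sides (\<open>z = 0\<close>) to the horizontal ones.
\<close>

definition saddle_VH :: surface where
  "saddle_VH = {(x, y, z). x \<in> {0..1} \<and> y \<in> {0..1} \<and> z \<in> {0..1} \<and>
                  (1 - z) * (x * (1 - x)) = z * (y * (1 - y))} \<union>
               {0, 1} \<times> ({-1/4..0} \<union> {1..5/4}) \<times> {0..1}"

definition saddle_HV :: surface where
  "saddle_HV = {(x, y, z). (x, y, 1 - z) \<in> saddle_VH}"

definition delta_plus :: chain where "delta_plus = frag_of saddle_VH"
definition delta_minus :: chain where "delta_minus = frag_of saddle_HV"

definition tubed_sheets :: surface where
  "tubed_sheets =
     {(x, y, z). x \<in> {0, 1} \<and> y \<in> {-1/4..5/4} \<and> z \<in> {0..1} \<and> 1/4 \<le> max \<bar>y - 1/2\<bar> \<bar>z - 1/2\<bar>} \<union>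
     {(x, y, z). x \<in> {0..1} \<and> max \<bar>y - 1/2\<bar> \<bar>z - 1/2\<bar> = 1/4}"

text \<open>The left sheet with a handle bounds the half-space to its left enlarged by a solid arch.\<close>

definition half_space_with_arch :: "space set" where
  "half_space_with_arch = {(x, y, z). x \<le> 0 \<or>
     (x \<le> 1/2 \<and> 1/4 \<le> y \<and> y \<le> 3/4 \<and> 1/4 \<le> z \<and> z \<le> 3/4 \<and>
      \<not> (x < 1/4 \<and> 3/8 < y \<and> y < 5/8))}"

definition handled_sheets :: surface where
  "handled_sheets =
     {(x, y, z). (x, y, z) \<in> frontier half_space_with_arch \<and> y \<in> {-1/4..5/4} \<and> z \<in> {0..1}} \<union>
     {1} \<times> {-1/4..5/4} \<times> {0..1}"

definition Phi :: chain where
  "Phi = frag_of tubed_sheets - frag_of handled_sheets"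

subsection \<open>Inserting local pictures\<close>

text \<open>
  The crossing between positions \<open>i\<close> and \<open>i + 1\<close> uses the unit square with lower left corner
  \<open>(i, 1)\<close>, \<open>(i, 3)\<close> or \<open>(i, 5)\<close>.
\<close>

fun corner :: "side \<Rightarrow> crossing \<Rightarrow> plane" where
  "corner L Cb = (1, 1)" | "corner L Cc = (2, 3)" | "corner L Ca = (1, 5)"
| "corner R Cb = (2, 1)" | "corner R Cc = (1, 3)" | "corner R Ca = (2, 5)"

definition box :: "side \<Rightarrow> crossing \<Rightarrow> plane set" where
  "box X k = (\<lambda>p. corner X k + p) ` local_box"

definition tangle :: "side \<Rightarrow> state \<Rightarrow> tangle" where
  "tangle X s = ({1, 2, 3} \<times> {0..7} - (\<Union>k. box X k)) \<union>
                (\<Union>k. (\<lambda>p. corner X k + p) ` arcs (s k))"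

definition insert_surface :: "side \<Rightarrow> crossing \<Rightarrow> state \<Rightarrow> surface \<Rightarrow> surface" where
  "insert_surface X k s W = product_surface (tangle X s - box X k) \<union>
     (\<lambda>(x, y, z). (fst (corner X k) + x, snd (corner X k) + y, z)) ` W"

definition at_crossing :: "side \<Rightarrow> crossing \<Rightarrow> state \<Rightarrow> chain \<Rightarrow> chain" where
  "at_crossing X k s c = frag_extend (\<lambda>W. frag_of (insert_surface X k s W)) c"


section \<open>Complexes and graded morphisms\<close>

record complex =
  summands :: "int \<Rightarrow> state set"
  object :: "state \<Rightarrow> tangle"
  differential :: "int \<Rightarrow> state \<Rightarrow> state \<Rightarrow> chain"

text \<open>A homogeneous family of matrices of chains, indexed by homological degree of the source.\<close>

record graded_morphism =
  src :: complex
  tgt :: complex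
  hdeg :: int
  component :: "int \<Rightarrow> state \<Rightarrow> state \<Rightarrow> chain"

definition graded_comp :: "graded_morphism \<Rightarrow> graded_morphism \<Rightarrow> graded_morphism"
    (infixr \<open>\<circledcirc>\<close> 70) where
  "g \<circledcirc> f = \<lparr>src = src f, tgt = tgt g, hdeg = hdeg f + hdeg g,
     component = (\<lambda>i s u. \<Sum>t\<in>summands (tgt f) (i + hdeg f).
                    component g (i + hdeg f) t u \<odot> component f i s t)\<rparr>"

definition graded_diff :: "graded_morphism \<Rightarrow> graded_morphism \<Rightarrow> graded_morphism"
    (infixl \<open>\<ominus>\<close> 65) where
  "f \<ominus> g = f\<lparr>component := (\<lambda>i s t. component f i s t - component g i s t)\<rparr>"

definition graded_zero :: "complex \<Rightarrow> complex \<Rightarrow> int \<Rightarrow> graded_morphism" where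
  "graded_zero K K' n = \<lparr>src = K, tgt = K', hdeg = n, component = (\<lambda>i s t. 0)\<rparr>"

definition graded_eq :: "graded_morphism \<Rightarrow> graded_morphism \<Rightarrow> bool" (infix \<open>\<doteq>\<close> 50) where
  "f \<doteq> g \<longleftrightarrow> src f = src g \<and> tgt f = tgt g \<and> hdeg f = hdeg g \<and>
     (\<forall>i. \<forall>s\<in>summands (src f) i. \<forall>t\<in>summands (tgt f) (i + hdeg f).
        cob_class (object (src f) s) (object (tgt f) t) (component f i s t) =
        cob_class (object (src f) s) (object (tgt f) t) (component g i s t))"

subsection \<open>The complex of a diagram\<close>

fun allowed :: "crossing_entry \<Rightarrow> smoothing set" where
  "allowed Pos = {V, H}" | "allowed Neg = {V, H}" | "allowed (Smooth r) = {r}"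

fun local_degree :: "crossing_entry \<Rightarrow> smoothing \<Rightarrow> int" where
  "local_degree Neg H = -1" | "local_degree Pos H = 1" | "local_degree _ _ = 0"

fun local_differential :: "crossing_entry \<Rightarrow> smoothing \<Rightarrow> smoothing \<Rightarrow> chain" where
  "local_differential Neg H V = delta_minus"
| "local_differential Pos V H = - delta_plus"
| "local_differential _ _ _ = 0"

text \<open>Koszul signs of the tensor product are taken along the diagram from top to bottom.\<close>

fun above :: "crossing \<Rightarrow> crossing set" where
  "above Ca = {}" | "above Cc = {Ca}" | "above Cb = {Ca, Cc}"

fun bracket :: "diagram \<Rightarrow> complex" (\<open>\<lbrakk>_\<rbrakk>\<close>) where
  "\<lbrakk>(X, e)\<rbrakk> =
     \<lparr>summands = (\<lambda>i. {s. (\<forall>k. s k \<in> allowed (e k)) \<and>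
                          (\<Sum>k\<in>{Ca, Cb, Cc}. local_degree (e k) (s k)) = i}),
      object = tangle X,
      differential = (\<lambda>i s t. \<Sum>k\<in>{Ca, Cb, Cc}.
        if s k \<noteq> t k \<and> t = s(k := t k)
        then frag_cmul (if even (\<Sum>j\<in>above k. local_degree (e j) (s j)) then 1 else -1)
               (at_crossing X k s (local_differential (e k) (s k) (t k)))
        else 0)\<rparr>"

text \<open>The crossing change at \<open>k\<close>, for a diagram whose crossing \<open>k\<close> is negative.\<close>

fun Phi_hat :: "crossing \<Rightarrow> diagram \<Rightarrow> graded_morphism" where
  "Phi_hat k (X, e) = \<lparr>src = \<lbrakk>(X, e)\<rbrakk>, tgt = \<lbrakk>(X, e(k := Pos))\<rbrakk>, hdeg = 0,
     component = (\<lambda>i s t. if s k = V \<and> t = s then at_crossing X k s Phi else 0)\<rparr>"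


section \<open>The Reidemeister III morphisms\<close>

abbreviation "VVV \<equiv> triple V V V"
abbreviation "VVH \<equiv> triple V V H"
abbreviation "VHV \<equiv> triple V H V"
abbreviation "HVV \<equiv> triple H V V"
abbreviation "HHV \<equiv> triple H H V"
abbreviation "VHH \<equiv> triple V H H"
abbreviation "HVH \<equiv> triple H V H"
abbreviation "HHH \<equiv> triple H H H"

subsection \<open>Elementary cobordisms\<close>

definition saddle_at_VH :: "side \<Rightarrow> crossing \<Rightarrow> state \<Rightarrow> arrow" where
  "saddle_at_VH X k s = (tangle X (s(k := V)), tangle X (s(k := H)),
     at_crossing X k (s(k := V)) delta_plus)"

definition saddle_at_HV :: "side \<Rightarrow> crossing \<Rightarrow> state \<Rightarrow> arrow" where
  "saddle_at_HV X k s = (tangle X (s(k := H)), tangle X (s(k := V)),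
     at_crossing X k (s(k := H)) delta_minus)"

definition s1 :: arrow where "s1 = saddle_at_VH R Cc VVV"
definition s2 :: arrow where "s2 = saddle_at_VH L Cc VVV"
definition s1_star :: arrow where "s1_star = saddle_at_HV R Cc VVV"
definition s2_star :: arrow where "s2_star = saddle_at_HV L Cc VVV"

definition sigma_Q_e2 :: arrow where "sigma_Q_e2 = saddle_at_HV L Ca VVH"
definition sigma_P_e2 :: arrow where "sigma_P_e2 = saddle_at_HV L Cb VVH"
definition sigma_e1_P :: arrow where "sigma_e1_P = saddle_at_VH R Ca VVH"
definition sigma_e1_Q :: arrow where "sigma_e1_Q = saddle_at_VH R Cb VVH"

text \<open>
  The states \<open>HHV\<close> of \<open>R\<close> and \<open>L\<close> contain the boundary of a rectangle as their circle.
\<close>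

definition eta2 :: arrow where
  "eta2 = (let rect = {2..3} \<times> {2..5}; T = tangle R HHV - frontier rect in
     (T, tangle R HHV, frag_of (product_surface T \<union>
        {(x, y, z). (x, y) \<in> frontier rect \<and> 1/2 \<le> z \<and> z \<le> 1} \<union> at_time (1/2) rect)))"

definition eps1 :: arrow where
  "eps1 = (let rect = {1..2} \<times> {2..5}; T = tangle L HHV - frontier rect in
     (tangle L HHV, T, frag_of (product_surface T \<union>
        {(x, y, z). (x, y) \<in> frontier rect \<and> 0 \<le> z \<and> z \<le> 1/2} \<union> at_time (1/2) rect)))"

subsection \<open>Building blocks\<close>

text \<open>
  A family is listed by its nonzero components: source degree, source state of \<open>L\<close>, target state
  of \<open>R\<close>, coefficient, and the morphism as a function of the source and target tangles.
\<close>

type_synonym family = "int \<Rightarrow> state \<Rightarrow> state \<Rightarrow> chain"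

fun family :: "(int \<times> state \<times> state \<times> int \<times> (tangle \<Rightarrow> tangle \<Rightarrow> chain)) list \<Rightarrow> family" where
  "family [] i s t = 0"
| "family ((j, u, v, n, m) # bs) i s t =
     (if i = j \<and> s = u \<and> t = v then frag_cmul n (m (tangle L s) (tangle R t)) else family bs i s t)"

definition omega_O :: family where
  "omega_O = family
    [(0, VVV, VVV, 1, iso),
     (0, VVV, HHV, 1, transport (eta2 \<cdot> s2)),
     (0, HHV, VVV, 1, transport (s1_star \<cdot> eps1)),
     (0, HHV, HHV, 1, transport (eta2 \<cdot> s2 \<cdot> s1_star \<cdot> eps1))]"

definition gamma_O :: family where
  "gamma_O = family
    [(-1, VHH, HVH, -1, iso),
     (0, VVH, HHH, -1, iso),
     (0, HHH, VVH, 1, iso),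
     (1, HVH, VHH, 1, iso)]"

definition F_O_minus :: family where
  "F_O_minus = family
    [(0, VVH, HVV, 1, iso),
     (1, HVH, HHV, 1, transport (eta2 \<cdot> sigma_Q_e2))]"

definition F_O_plus :: family where
  "F_O_plus = family
    [(0, HHV, HVH, 1, transport (sigma_e1_P \<cdot> eps1)),
     (1, HVV, VVH, 1, iso)]"

definition G_O :: family where
  "G_O = family
    [(0, VVV, HVV, -1, transport s2),
     (0, HHV, HVV, -1, transport (s2 \<cdot> s1_star \<cdot> eps1)),
     (1, HVV, VVV, 1, transport s1_star),
     (1, HVV, HHV, 1, transport (eta2 \<cdot> s2 \<cdot> s1_star))]"

definition Psi_O_minus :: family where
  "Psi_O_minus = family [(1, HVH, HVV, -1, transport sigma_Q_e2)]"

definition Psi_O_plus :: family where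
  "Psi_O_plus = family [(1, HVV, HVH, -1, transport sigma_e1_P)]"

definition omega_U :: family where
  "omega_U = family
    [(0, VVV, VVV, 1, iso),
     (0, VVV, HHV, -1, transport (eta2 \<cdot> s2)),
     (0, HHV, VVV, -1, transport (s1_star \<cdot> eps1)),
     (0, HHV, HHV, 1, transport (eta2 \<cdot> s2 \<cdot> s1_star \<cdot> eps1))]"

definition gamma_U :: family where
  "gamma_U = family
    [(-1, HVH, VHH, 1, iso),
     (0, VVH, HHH, -1, iso),
     (0, HHH, VVH, 1, iso),
     (1, VHH, HVH, -1, iso)]"

definition F_U_minus :: family where
  "F_U_minus = family
    [(0, VVH, VHV, 1, iso),
     (1, VHH, HHV, -1, transport (eta2 \<cdot> sigma_P_e2))]"

definition F_U_plus :: family where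
  "F_U_plus = family
    [(0, HHV, VHH, -1, transport (sigma_e1_Q \<cdot> eps1)),
     (1, VHV, VVH, 1, iso)]"

definition G_U :: family where
  "G_U = family
    [(0, VVV, VHV, -1, transport s2),
     (0, HHV, VHV, 1, transport (s2 \<cdot> s1_star \<cdot> eps1)),
     (1, VHV, VVV, 1, transport s1_star),
     (1, VHV, HHV, -1, transport (eta2 \<cdot> s2 \<cdot> s1_star))]"

definition Psi_U_minus :: family where
  "Psi_U_minus = family [(1, VHH, VHV, -1, transport sigma_P_e2)]"

definition Psi_U_plus :: family where
  "Psi_U_plus = family [(1, VHV, VHH, -1, transport sigma_e1_Q)]"

subsection \<open>Assembled morphisms\<close>

text \<open>
  States with \<open>c\<close> smoothed as \<open>H\<close> have degree \<open>i\<close> in the complex of \<open>X(x, y, -)\<close> iff they have degree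
  \<open>i + 1\<close> in that of \<open>X(x, y, H)\<close>, and degree \<open>i\<close> in that of \<open>X(x, y, +)\<close> iff \<open>i - 1\<close>.
\<close>

definition R_minus_matrix :: "family \<Rightarrow> family \<Rightarrow> family \<Rightarrow> family" where
  "R_minus_matrix omega F gamma i s t = (case (s Cc, t Cc) of
     (V, V) \<Rightarrow> - omega i s t | (H, V) \<Rightarrow> - F (i + 1) s t
   | (V, H) \<Rightarrow> 0             | (H, H) \<Rightarrow> gamma (i + 1) s t)"

definition R_plus_matrix :: "family \<Rightarrow> family \<Rightarrow> family \<Rightarrow> family" where
  "R_plus_matrix gamma F omega i s t = (case (s Cc, t Cc) of
     (H, H) \<Rightarrow> gamma (i - 1) s t | (V, H) \<Rightarrow> - F i s t
   | (H, V) \<Rightarrow> 0                 | (V, V) \<Rightarrow> omega i s t)"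

definition psi_matrix :: "family \<Rightarrow> family \<Rightarrow> family \<Rightarrow> family" where
  "psi_matrix Psi_plus G Psi_minus i s t = (case (s Cc, t Cc) of
     (V, H) \<Rightarrow> - Psi_plus i s t | (H, H) \<Rightarrow> 0
   | (V, V) \<Rightarrow> G i s t          | (H, V) \<Rightarrow> - Psi_minus (i + 1) s t)"

definition R_O_minus :: graded_morphism where
  "R_O_minus = \<lparr>src = \<lbrakk>diagram L Pos Neg Neg\<rbrakk>, tgt = \<lbrakk>diagram R Neg Pos Neg\<rbrakk>, hdeg = 0,
     component = R_minus_matrix omega_O F_O_minus gamma_O\<rparr>"

definition R_O_plus :: graded_morphism where
  "R_O_plus = \<lparr>src = \<lbrakk>diagram L Pos Neg Pos\<rbrakk>, tgt = \<lbrakk>diagram R Neg Pos Pos\<rbrakk>, hdeg = 0,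
     component = R_plus_matrix gamma_O F_O_plus omega_O\<rparr>"

definition R_U_minus :: graded_morphism where
  "R_U_minus = \<lparr>src = \<lbrakk>diagram L Neg Pos Neg\<rbrakk>, tgt = \<lbrakk>diagram R Pos Neg Neg\<rbrakk>, hdeg = 0,
     component = R_minus_matrix omega_U F_U_minus gamma_U\<rparr>"

definition R_U_plus :: graded_morphism where
  "R_U_plus = \<lparr>src = \<lbrakk>diagram L Neg Pos Pos\<rbrakk>, tgt = \<lbrakk>diagram R Pos Neg Pos\<rbrakk>, hdeg = 0,
     component = R_plus_matrix gamma_U F_U_plus omega_U\<rparr>"

definition psi_O :: graded_morphism where
  "psi_O = \<lparr>src = \<lbrakk>diagram L Pos Neg Neg\<rbrakk>, tgt = \<lbrakk>diagram R Neg Pos Pos\<rbrakk>, hdeg = -1,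
     component = psi_matrix Psi_O_plus G_O Psi_O_minus\<rparr>"

definition psi_U :: graded_morphism where
  "psi_U = \<lparr>src = \<lbrakk>diagram L Neg Pos Neg\<rbrakk>, tgt = \<lbrakk>diagram R Pos Neg Pos\<rbrakk>, hdeg = -1,
     component = psi_matrix Psi_U_plus G_U Psi_U_minus\<rparr>"

end

theory Submission
  imports Defs
begin

text \<open>
  Among states smoothed as \<open>V\<close> at the changed crossing, \<open>\<psi>\<close> has no nonzero component and the
  Reidemeister morphisms have only \<open>VVV \<rightarrow> VVV\<close>, which is plus or minus the identity. On three
  vertical strands \<open>\<Phi>\<^sub>a\<close> and \<open>\<Phi>\<^sub>b\<close> differ only in the height at which the tube or handle is attached,
  and an isotopy sliding the slab \<open>5 \<le> y \<le> 6\<close> down to \<open>1 \<le> y \<le> 2\<close> carries one composite to the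
  other; no sphere, torus or four-tube relation is needed.
\<close>

section \<open>The sliding isotopy\<close>

text \<open>
  The map \<open>slide s\<close> is the piecewise linear homeomorphism of \<open>{0..7}\<close> that translates \<open>{5..6}\<close> by
  \<open>-4 s\<close>; it is convex, hence a maximum of affine functions. The amount \<open>s\<close> is 1 for
  \<open>1 \<le> x \<le> 3\<close>, \<open>1/16 \<le> z \<le> 7/8\<close>, which contains the tubes and handles of both factors, and falls to
  0 at the faces \<open>x \<in> {0, 4}\<close> and \<open>z \<in> {0, 1}\<close>.
\<close>

definition slide :: "real \<Rightarrow> real \<Rightarrow> real" where
  "slide s y = max (y * (1 - 4 * s / 5)) (max (y - 4 * s) (7 - (7 - y) * (1 + 4 * s)))"

definition slide_amount :: "real \<Rightarrow> real \<Rightarrow> real" where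
  "slide_amount x z = min 1 (min (min x (4 - x)) (16 * min z (1 - z)))"

definition slide_isotopy :: "real \<Rightarrow> space \<Rightarrow> space" where
  "slide_isotopy t = (\<lambda>(x, y, z). (x, slide (t * slide_amount x z) y, z))"

lemma slide_0 [simp]: "slide 0 y = y"
  by (simp add: slide_def)

text \<open>For \<open>0 \<le> s \<le> 1\<close> all three affine pieces have positive slope, and a
  maximum of strictly increasing functions is strictly increasing.\<close>

lemma slide_strict_mono:
  assumes "0 \<le> s" "s \<le> 1" "y < y'"
  shows "slide s y < slide s y'"
proof -
  have "y * (1 - 4 * s / 5) < y' * (1 - 4 * s / 5)"
    using assms by (intro mult_strict_right_mono) auto
  moreover have "(7 - y') * (1 + 4 * s) < (7 - y) * (1 + 4 * s)"
    using assms by (intro mult_strict_right_mono) auto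
  ultimately show ?thesis
    using assms unfolding slide_def by linarith
qed

lemma slide_endpoints:
  assumes "0 \<le> s" "s \<le> 1"
  shows "slide s 0 = 0" "slide s 7 = 7"
  using assms by (auto simp: slide_def max_def algebra_simps)

text \<open>Strict monotonicity gives injectivity; the fixed endpoints and the intermediate value
  theorem give surjectivity.\<close>

lemma bij_betw_slide:
  assumes "0 \<le> s" "s \<le> 1"
  shows "bij_betw (slide s) {0..7} {0..7}"
proof -
  have mono: "slide s y \<le> slide s y'" if "y \<le> y'" for y y'
    using slide_strict_mono[OF assms, of y y'] that by (cases "y = y'") auto
  have "inj (slide s)"
    using slide_strict_mono[OF assms] by (metis injI linorder_neqE_linordered_idom less_irrefl)
  moreover have "slide s ` {0..7} \<subseteq> {0..7}"
    using mono[of 0] mono[of _ 7] slide_endpoints[OF assms] by auto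
  moreover have "\<exists>y\<in>{0..7}. slide s y = v" if "v \<in> {0..7}" for v
  proof -
    have "continuous_on {0..7} (slide s)"
      unfolding slide_def by (intro continuous_intros)
    then have "\<exists>y\<ge>0. y \<le> 7 \<and> slide s y = v"
      using IVT'[of "slide s" 0 v 7] that slide_endpoints[OF assms] by auto
    then show ?thesis by auto
  qed
  then have "{0..7} \<subseteq> slide s ` {0..7}" by (metis imageI subsetI)
  ultimately show ?thesis
    unfolding bij_betw_def by (auto intro: inj_on_subset)
qed

text \<open>The equivalence also says that no height outside the slab
  \<open>5 \<le> y \<le> 6\<close> is moved into \<open>1 \<le> y \<le> 2\<close>, so nothing else
  lands where the tubes and handles arrive.\<close>

lemma slide_1_slab:
  assumes "0 \<le> y" "y \<le> 7"
  shows "1 \<le> slide 1 y \<and> slide 1 y \<le> 2 \<longleftrightarrow> 5 \<le> y \<and> y \<le> 6"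
    and "5 \<le> y \<Longrightarrow> y \<le> 6 \<Longrightarrow> slide 1 y = y - 4"
  using assms by (auto simp: slide_def max_def)

section \<open>From the interval to the cylinder\<close>

lemma slide_amount_bounds:
  assumes "(x, y, z) \<in> cylinder" "0 \<le> t" "t \<le> 1"
  shows "0 \<le> t * slide_amount x z" "t * slide_amount x z \<le> 1"
proof -
  have "0 \<le> slide_amount x z" "slide_amount x z \<le> 1"
    using assms by (auto simp: slide_amount_def cylinder_def)
  with assms show "0 \<le> t * slide_amount x z" "t * slide_amount x z \<le> 1"
    by (auto intro: mult_le_one)
qed

text \<open>The map preserves every segment with \<open>x\<close> and \<open>z\<close> fixed. On
  such a segment the slide amount is constant, so \<open>bij_betw_slide\<close> applies segment by
  segment.\<close>

lemma bij_betw_slide_isotopy: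
  assumes "0 \<le> t" "t \<le> 1"
  shows "bij_betw (slide_isotopy t) cylinder cylinder"
proof -
  have bij: "bij_betw (slide (t * slide_amount x z)) {0..7} {0..7}"
    if "(x, y, z) \<in> cylinder" for x y z
    using bij_betw_slide slide_amount_bounds[OF that assms] by blast
  have inj: "inj_on (slide_isotopy t) cylinder"
  proof (rule inj_onI)
    fix p q assume p: "p \<in> cylinder" and q: "q \<in> cylinder"
      and eq: "slide_isotopy t p = slide_isotopy t q"
    obtain x y z where p': "p = (x, y, z)" by (cases p)
    obtain y' where q': "q = (x, y', z)"
      using eq by (cases q) (auto simp: p' slide_isotopy_def)
    have "y \<in> {0..7}" "y' \<in> {0..7}" using p q by (auto simp: p' q' cylinder_def)
    moreover have "slide (t * slide_amount x z) y = slide (t * slide_amount x z) y'"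
      using eq by (simp add: p' q' slide_isotopy_def)
    ultimately have "y = y'"
      using bij[OF p[unfolded p']] unfolding bij_betw_def by (metis inj_onD)
    then show "p = q" by (simp add: p' q')
  qed
  have "slide_isotopy t ` cylinder \<subseteq> cylinder"
  proof
    fix q assume "q \<in> slide_isotopy t ` cylinder"
    then obtain x y z where p: "(x, y, z) \<in> cylinder"
      and q: "q = (x, slide (t * slide_amount x z) y, z)"
      by (auto simp: slide_isotopy_def)
    have "slide (t * slide_amount x z) y \<in> {0..7}"
      using bij_betwE[OF bij[OF p]] p by (auto simp: cylinder_def)
    then show "q \<in> cylinder" using p by (auto simp: q cylinder_def)
  qed
  moreover have "cylinder \<subseteq> slide_isotopy t ` cylinder"
  proof
    fix q assume q: "q \<in> cylinder"
    obtain x v z where q': "q = (x, v, z)" by (cases q)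
    have "v \<in> slide (t * slide_amount x z) ` {0..7}"
      using bij[of x v z] q by (auto simp: q' bij_betw_def cylinder_def)
    then obtain y where "y \<in> {0..7}" "v = slide (t * slide_amount x z) y" by auto
    then have "q = slide_isotopy t (x, y, z)" "(x, y, z) \<in> cylinder"
      using q by (auto simp: q' slide_isotopy_def cylinder_def)
    then show "q \<in> slide_isotopy t ` cylinder" by blast
  qed
  ultimately show ?thesis using inj by (auto simp: bij_betw_def)
qed

lemma frontier_cylinder:
  assumes "(x, y, z) \<in> frontier cylinder"
  shows "(x, y, z) \<in> cylinder" "x = 0 \<or> x = 4 \<or> y = 0 \<or> y = 7 \<or> z = 0 \<or> z = 1"
proof -
  have "closed cylinder"
    by (simp add: cylinder_def closed_Times)
  then show in_cyl: "(x, y, z) \<in> cylinder"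
    using assms frontier_subset_closed by blast
  have "(x, y, z) \<notin> {0<..<4} \<times> {0<..<7} \<times> {0<..<1}"
    using assms by (simp add: cylinder_def frontier_def interior_Times)
  then show "x = 0 \<or> x = 4 \<or> y = 0 \<or> y = 7 \<or> z = 0 \<or> z = 1"
    using in_cyl by (auto simp: cylinder_def)
qed

lemma ambient_isotopy_slide: "ambient_isotopy cylinder slide_isotopy"
  unfolding ambient_isotopy_def
proof (intro conjI ballI)
  have cont: "continuous_on A (\<lambda>(t, p). slide_isotopy t p)" for A
    unfolding slide_isotopy_def slide_def slide_amount_def split_beta
    by (intro continuous_intros) auto
  then show "continuous_on ({0..1} \<times> cylinder) (\<lambda>(t, p). slide_isotopy t p)" .
  fix t :: real assume t: "t \<in> {0..1}"
  have "continuous_on cylinder (slide_isotopy t)"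
    unfolding slide_isotopy_def slide_def slide_amount_def split_beta
    by (intro continuous_intros) auto
  moreover have "compact cylinder"
    by (simp add: cylinder_def compact_Times)
  \<comment> \<open>A continuous bijection from a compact space to a Hausdorff space has a
    continuous inverse.\<close>
  ultimately show "\<exists>g. homeomorphism cylinder cylinder (slide_isotopy t) g"
    using bij_betw_slide_isotopy[of t] t
    by (intro homeomorphism_compact) (auto simp: bij_betw_def)
  fix p assume p: "p \<in> frontier cylinder"
  obtain x y z where p': "p = (x, y, z)" by (cases p)
  note fr = frontier_cylinder[OF p[unfolded p']]
  have "slide (t * slide_amount x z) y = y"
  \<comment> \<open>On the faces \<open>y = 0\<close> and \<open>y = 7\<close> the amount may be
    positive, but every slide fixes 0 and 7; on the remaining faces the amount is 0.\<close>
  proof (cases "y = 0 \<or> y = 7")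
    case True
    then show ?thesis
      using slide_endpoints[OF slide_amount_bounds[OF fr(1)]] t by auto
  next
    case False
    then have "slide_amount x z = 0"
      using fr by (auto simp: slide_amount_def cylinder_def min_def)
    then show ?thesis by simp
  qed
  then show "slide_isotopy t p = p" by (simp add: p' slide_isotopy_def)
qed (auto simp: slide_isotopy_def)

section \<open>Surfaces over three vertical strands\<close>

text \<open>This is all that the isotopy has to know about the tube and the handle. The bounds 1/4
  and 3/4 on \<open>z\<close> leave collars in time, so that stacked copies meet along straight
  sheets.\<close>

definition localized :: "surface \<Rightarrow> bool" where
  "localized W \<longleftrightarrow> W \<subseteq> {0..1} \<times> {-1/4..5/4} \<times> {0..1} \<and>
     (\<forall>x y z. y \<in> {-1/4..5/4} \<and> z \<in> {0..1} \<and> \<not> (y \<in> {0..1} \<and> z \<in> {1/4..3/4}) \<longrightarrow>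
        (x, y, z) \<in> W \<longleftrightarrow> x \<in> {0, 1})"

lemma localized_tubed_sheets: "localized tubed_sheets"
  unfolding localized_def tubed_sheets_def by (auto simp: max_def abs_if split: if_splits)

text \<open>The open half-space \<open>x < 0\<close> lies in the interior, and the closed half-space
  \<open>x \<le> 1/2\<close> contains the closure.\<close>

lemma frontier_half_space_with_arch_bounds:
  assumes "p \<in> frontier half_space_with_arch"
  shows "0 \<le> fst p" "fst p \<le> 1/2"
proof -
  have "open {p::space. fst p < 0}"
    by (intro open_Collect_less continuous_intros)
  then have "{p::space. fst p < 0} \<subseteq> interior half_space_with_arch"
    by (intro interior_maximal) (auto simp: half_space_with_arch_def)
  moreover have "closed {p::space. fst p \<le> 1/2}"
    by (intro closed_Collect_le continuous_intros)
  then have "closure half_space_with_arch \<subseteq> {p. fst p \<le> 1/2}"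
    by (intro closure_minimal) (auto simp: half_space_with_arch_def)
  ultimately have "p \<notin> {p. fst p < 0}" "p \<in> {p. fst p \<le> 1/2}"
    using assms unfolding frontier_def by blast+
  then show "0 \<le> fst p" "fst p \<le> 1/2"
    by simp_all
qed

lemma frontier_half_space: "frontier {p::space. fst p \<le> 0} = {p. fst p = 0}"
  using frontier_halfspace_le[of "(1::real, 0::real, 0::real)" 0]
  by (simp add: inner_prod_def split_beta zero_prod_def)

text \<open>Taking closures is local on open sets. This is applied to both sets and to their
  complements, because a frontier is the intersection of two closures.\<close>

lemma open_Int_frontier_subset:
  fixes A B U :: "'a::topological_space set"
  assumes "open U" "A \<inter> U = B \<inter> U"
  shows "U \<inter> frontier A \<subseteq> frontier B"
proof -
  have "U \<inter> closure A \<subseteq> closure B" if "A \<inter> U = B \<inter> U" for A B :: "'a set"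
    using open_Int_closure_subset[OF assms(1), of A] closure_mono[of "U \<inter> A" B] that by auto
  from this[of A B] this[of "- A" "- B"] show ?thesis
    using assms(2) by (auto simp: frontier_closures)
qed

text \<open>Off the slab containing the arch the solid coincides with the half-space
  \<open>x \<le> 0\<close>, and frontiers are local.\<close>

lemma frontier_half_space_with_arch_off_slab:
  assumes "\<not> (1/4 \<le> y \<and> y \<le> 3/4 \<and> 1/4 \<le> z \<and> z \<le> 3/4)"
  shows "(x, y, z) \<in> frontier half_space_with_arch \<longleftrightarrow> x = 0"
proof -
  define U where "U = - (UNIV \<times> {1/4..3/4} \<times> {1/4..3/4} :: space set)"
  have "open U"
    unfolding U_def by (intro open_Compl closed_Times) auto
  moreover have "q \<in> half_space_with_arch \<longleftrightarrow> fst q \<le> 0" if "q \<in> U" for q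
    using that by (cases q) (simp add: half_space_with_arch_def U_def, blast)
  then have "half_space_with_arch \<inter> U = {p. fst p \<le> 0} \<inter> U" by blast
  ultimately have "U \<inter> frontier half_space_with_arch = U \<inter> frontier {p. fst p \<le> 0}"
    using open_Int_frontier_subset[of U half_space_with_arch "{p. fst p \<le> 0}"]
      open_Int_frontier_subset[of U "{p. fst p \<le> 0}" half_space_with_arch] by blast
  moreover have "(x, y, z) \<in> U" using assms by (auto simp: U_def)
  ultimately have "(x, y, z) \<in> frontier half_space_with_arch \<longleftrightarrow>
      (x, y, z) \<in> frontier {p. fst p \<le> 0}"
    by blast
  then show ?thesis by (simp add: frontier_half_space)
qed

lemma localized_handled_sheets: "localized handled_sheets"
  unfolding localized_def
proof (intro conjI allI impI)
  show "handled_sheets \<subseteq> {0..1} \<times> {-1/4..5/4} \<times> {0..1}"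
  proof
    fix p assume p: "p \<in> handled_sheets"
    obtain x y z where p': "p = (x, y, z)" by (cases p)
    show "p \<in> {0..1} \<times> {-1/4..5/4} \<times> {0..1}"
      using p frontier_half_space_with_arch_bounds[of p] by (auto simp: p' handled_sheets_def)
  qed
  fix x y z :: real
  assume "y \<in> {-1/4..5/4} \<and> z \<in> {0..1} \<and> \<not> (y \<in> {0..1} \<and> z \<in> {1/4..3/4})"
  then show "(x, y, z) \<in> handled_sheets \<longleftrightarrow> x \<in> {0, 1}"
    using frontier_half_space_with_arch_off_slab[of y z x] by (auto simp: handled_sheets_def)
qed

section \<open>Inserting and stacking local surfaces on vertical strands\<close>

lemma UNIV_crossing: "UNIV = {Ca, Cb, Cc}"
  using crossing.exhaust by auto

lemma all_crossing: "(\<forall>k. P k) \<longleftrightarrow> P Ca \<and> P Cb \<and> P Cc"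
  using crossing.exhaust by metis

text \<open>The set is the same for \<open>L\<close> and \<open>R\<close>, so \<open>iso\<close>
  between the two \<open>VVV\<close> tangles is the product surface and involves no choice of an
  isotopy.\<close>

lemma tangle_VVV: "tangle X VVV = {1, 2, 3} \<times> {0..7}"
proof -
  have "triple V V V k = V" for k by (cases k) (auto simp: triple_def)
  then show ?thesis
    by (cases X) (auto simp: tangle_def UNIV_crossing box_def local_box_def image_iff
      Bex_def add_eq_0_iff)
qed

lemma mem_box: "(x, y) \<in> box X k \<longleftrightarrow>
   fst (corner X k) - 1/4 \<le> x \<and> x \<le> fst (corner X k) + 5/4 \<and>
   snd (corner X k) - 1/4 \<le> y \<and> y \<le> snd (corner X k) + 5/4"
proof -
  have "(x, y) \<in> box X k \<longleftrightarrow> (x, y) - corner X k \<in> local_box"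
    by (force simp: box_def image_iff)
  then show ?thesis by (auto simp: local_box_def minus_prod_def)
qed

text \<open>A normal form in which \<open>W\<close> enters only through one block, so that changing
  \<open>j\<close> visibly translates this block and leaves the straight sheets alone.\<close>

definition surface_with :: "real \<Rightarrow> real \<Rightarrow> surface \<Rightarrow> surface" where
  "surface_with i j W = {(x, y, z). 0 \<le> y \<and> y \<le> 7 \<and> 0 \<le> z \<and> z \<le> 1 \<and>
     (if i \<le> x \<and> x \<le> i + 1 \<and> j \<le> y \<and> y \<le> j + 1 \<and> 1/4 \<le> z \<and> z \<le> 3/4
      then (x - i, y - j, z) \<in> W else x \<in> {1, 2, 3})}"

lemma insert_surface_VVV:
  assumes W: "localized W" and ij: "corner X k = (i, j)"
  shows "insert_surface X k VVV W = surface_with i j W"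
proof -
  have sub: "0 \<le> x \<and> x \<le> 1 \<and> -1/4 \<le> y \<and> y \<le> 5/4 \<and> 0 \<le> z \<and> z \<le> 1"
    if "(x, y, z) \<in> W" for x y z
    using W that by (auto simp: localized_def)
  have off: "(x, y, z) \<in> W \<longleftrightarrow> x = 0 \<or> x = 1"
    if "-1/4 \<le> y" "y \<le> 5/4" "0 \<le> z" "z \<le> 1" "\<not> (0 \<le> y \<and> y \<le> 1 \<and> 1/4 \<le> z \<and> z \<le> 3/4)" for x y z
    using W that by (auto simp: localized_def)
  have ij': "i \<in> {1, 2}" "j \<in> {1, 3, 5}"
    using ij by (cases X; cases k; auto)+
  have "(x, y, z) \<in> insert_surface X k VVV W \<longleftrightarrow>
      (x \<in> {1, 2, 3} \<and> 0 \<le> y \<and> y \<le> 7 \<and> 0 \<le> z \<and> z \<le> 1 \<and>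
        \<not> (i - 1/4 \<le> x \<and> x \<le> i + 5/4 \<and> j - 1/4 \<le> y \<and> y \<le> j + 5/4)) \<or>
      (x - i, y - j, z) \<in> W" for x y z
    unfolding insert_surface_def product_surface_def
    by (force simp: tangle_VVV mem_box ij image_iff)
  moreover have "((x \<in> {1, 2, 3} \<and> 0 \<le> y \<and> y \<le> 7 \<and> 0 \<le> z \<and> z \<le> 1 \<and>
        \<not> (i - 1/4 \<le> x \<and> x \<le> i + 5/4 \<and> j - 1/4 \<le> y \<and> y \<le> j + 5/4)) \<or>
      (x - i, y - j, z) \<in> W) \<longleftrightarrow> (x, y, z) \<in> surface_with i j W" for x y z
  proof (cases "i \<le> x \<and> x \<le> i + 1 \<and> j \<le> y \<and> y \<le> j + 1 \<and> 1/4 \<le> z \<and> z \<le> 3/4")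
    case True
    then show ?thesis using ij' by (auto simp: surface_with_def)
  next
    case slab: False
    have surface: "(x, y, z) \<in> surface_with i j W \<longleftrightarrow>
        0 \<le> y \<and> y \<le> 7 \<and> 0 \<le> z \<and> z \<le> 1 \<and> x \<in> {1, 2, 3}"
      by (simp only: surface_with_def mem_Collect_eq prod.case if_not_P[OF slab])
    show ?thesis
    proof (cases "j - 1/4 \<le> y \<and> y \<le> j + 5/4 \<and> 0 \<le> z \<and> z \<le> 1")
      case True
      have W_iff: "(x - i, y - j, z) \<in> W \<longleftrightarrow> x = i \<or> x = i + 1"
      proof (cases "j \<le> y \<and> y \<le> j + 1 \<and> 1/4 \<le> z \<and> z \<le> 3/4")
        case True
        \<comment> \<open>Both sides are false here: \<open>x\<close> misses the interval, while
          \<open>W\<close> has first coordinates in \<open>{0..1}\<close>.\<close>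
        then have "\<not> (i \<le> x \<and> x \<le> i + 1)" using slab by blast
        then show ?thesis using sub[of "x - i" "y - j" z] by auto
      next
        case False
        then have "(x - i, y - j, z) \<in> W \<longleftrightarrow> x - i = 0 \<or> x - i = 1"
          using True by (intro off) auto
        then show ?thesis by auto
      qed
      have "0 \<le> y" "y \<le> 7" using True ij' by auto
      \<comment> \<open>As \<open>i\<close> is 1 or 2, the box removes exactly the strands
        \<open>i\<close> and \<open>i + 1\<close>, which \<open>W\<close> puts back.\<close>
      moreover have "x \<in> {1, 2, 3} \<and> i - 1/4 \<le> x \<and> x \<le> i + 5/4 \<longleftrightarrow> x = i \<or> x = i + 1"
        using ij' by auto
      ultimately show ?thesis
        unfolding surface W_iff using True by blast
    next
      case False
      then have "(x - i, y - j, z) \<notin> W" using sub[of "x - i" "y - j" z] by auto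
      then show ?thesis unfolding surface using False by blast
    qed
  qed
  ultimately show ?thesis by auto
qed

text \<open>The first factor is compressed in time by 4 and the last by 2, which turns the window
  \<open>1/4 \<le> z \<le> 3/4\<close> into \<open>1/16 \<le> z \<le> 3/16\<close> and
  \<open>5/8 \<le> z \<le> 7/8\<close>.\<close>

lemma stack_surfaces:
  assumes "j \<in> {1, 5}"
  shows "stack (stack (surface_with 1 j W) (product_surface ({1, 2, 3} \<times> {0..7})))
      (surface_with 2 j W') = {(x, y, z). 0 \<le> y \<and> y \<le> 7 \<and> 0 \<le> z \<and> z \<le> 1 \<and>
     (if j \<le> y \<and> y \<le> j + 1
      then if 1 \<le> x \<and> x \<le> 2 \<and> 1/16 \<le> z \<and> z \<le> 3/16 then (x - 1, y - j, 4 * z) \<in> W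
        else if 2 \<le> x \<and> x \<le> 3 \<and> 5/8 \<le> z \<and> z \<le> 7/8 then (x - 2, y - j, 2 * z - 1) \<in> W'
        else x \<in> {1, 2, 3}
      else x \<in> {1, 2, 3})}" (is "?S = ?N")
proof (intro set_eqI)
  fix p :: space
  obtain x y z where p: "p = (x, y, z)" by (cases p)
  show "p \<in> ?S \<longleftrightarrow> p \<in> ?N"
    unfolding p stack_def surface_with_def product_surface_def
    \<comment> \<open>At the seams \<open>z = 1/4\<close> and \<open>z = 1/2\<close> both layers
      contribute, and both are straight sheets there.\<close>
    by (cases "z \<le> 1/4"; cases "z < 1/2"; cases "z = 1/2"; auto)
qed

lemma isotopic_stack:
  "isotopic
     (stack (stack (surface_with 1 5 W) (product_surface ({1, 2, 3} \<times> {0..7})))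
        (surface_with 2 5 W'))
     (stack (stack (surface_with 1 1 W) (product_surface ({1, 2, 3} \<times> {0..7})))
        (surface_with 2 1 W'))" (is "isotopic (?S 5) (?S 1)")
proof -
  have bij: "bij_betw (slide_isotopy 1) cylinder cylinder"
    by (rule bij_betw_slide_isotopy) auto
  have sub: "?S j \<subseteq> cylinder" if "j \<in> {1, 5}" for j
  proof
    fix p assume "p \<in> ?S j"
    then show "p \<in> cylinder"
      unfolding stack_surfaces[OF that] by (cases p) (auto simp: cylinder_def split: if_splits)
  qed
  have iff: "slide_isotopy 1 p \<in> ?S 1 \<longleftrightarrow> p \<in> ?S 5" if p: "p \<in> cylinder" for p
  proof -
    obtain x y z where p': "p = (x, y, z)" by (cases p)
    let ?v = "slide (slide_amount x z) y"
    have y: "0 \<le> y" "y \<le> 7" using p by (auto simp: p' cylinder_def)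
    have v: "0 \<le> ?v" "?v \<le> 7"
      using bij_betwE[OF bij] p by (force simp: p' slide_isotopy_def cylinder_def)+
    have one: "slide_amount x z = 1" if "1 \<le> x" "x \<le> 3" "1/16 \<le> z" "z \<le> 7/8"
      using that by (auto simp: slide_amount_def min_def)
    have eq: "slide_isotopy 1 p = (x, ?v, z)" by (simp add: p' slide_isotopy_def)
    have slab: "(1 \<le> ?v \<and> ?v \<le> 2) \<longleftrightarrow> (5 \<le> y \<and> y \<le> 6)"
      if "1 \<le> x \<and> x \<le> 3 \<and> 1/16 \<le> z \<and> z \<le> 7/8"
      using one that slide_1_slab(1)[OF y] by simp
    \<comment> \<open>Inside, the slide is translation by -4. In the other two cases the point and
      its image both lie where the surfaces are straight sheets, on which membership depends only on
      \<open>x\<close> and \<open>z\<close>; these do not move.\<close>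
    consider (inside) "1 \<le> x" "x \<le> 3" "1/16 \<le> z" "z \<le> 7/8" "5 \<le> y" "y \<le> 6"
      | (beside) "\<not> (1 \<le> ?v \<and> ?v \<le> 2)" "\<not> (5 \<le> y \<and> y \<le> 6)"
      | (outside) "\<not> (1 \<le> x \<and> x \<le> 3 \<and> 1/16 \<le> z \<and> z \<le> 7/8)"
      using slab by blast
    then show ?thesis
    proof cases
      case inside
      then have v: "?v = y - 4" using one slide_1_slab[OF y] by simp
      have "(x, y - 4, z) \<in> ?S 1 \<longleftrightarrow> (x, y, z) \<in> ?S 5"
        using inside by (simp add: stack_surfaces)
      then show ?thesis unfolding eq v by (simp only: p')
    next
      case beside
      have "(x, ?v, z) \<in> ?S 1 \<longleftrightarrow> 0 \<le> z \<and> z \<le> 1 \<and> x \<in> {1, 2, 3}"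
        using v beside(1) by (auto simp: stack_surfaces)
      moreover have "(x, y, z) \<in> ?S 5 \<longleftrightarrow> 0 \<le> z \<and> z \<le> 1 \<and> x \<in> {1, 2, 3}"
        using y beside(2) by (auto simp: stack_surfaces)
      ultimately show ?thesis unfolding eq by (simp only: p')
    next
      case outside
      have "(x, ?v, z) \<in> ?S 1 \<longleftrightarrow> 0 \<le> z \<and> z \<le> 1 \<and> x \<in> {1, 2, 3}"
        using v outside by (auto simp: stack_surfaces)
      moreover have "(x, y, z) \<in> ?S 5 \<longleftrightarrow> 0 \<le> z \<and> z \<le> 1 \<and> x \<in> {1, 2, 3}"
        using y outside by (auto simp: stack_surfaces)
      ultimately show ?thesis unfolding eq by (simp only: p')
    qed
  qed
  have "slide_isotopy 1 ` ?S 5 = ?S 1"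
  proof (intro equalityI subsetI)
    fix q assume q: "q \<in> ?S 1"
    then have "q \<in> slide_isotopy 1 ` cylinder"
      using sub[of 1] bij by (auto simp: bij_betw_def)
    then obtain p where "p \<in> cylinder" "q = slide_isotopy 1 p" by blast
    then show "q \<in> slide_isotopy 1 ` ?S 5" using iff q by blast
  next
    fix q assume "q \<in> slide_isotopy 1 ` ?S 5"
    then show "q \<in> ?S 1" using sub[of 5] iff by auto
  qed
  then show ?thesis
    using ambient_isotopy_slide sub[of 5] unfolding isotopic_def by auto
qed

section \<open>Chains modulo the relations\<close>

text \<open>Containing 0 and being closed under differences makes the relations a subgroup.\<close>

lemma relations_minus: "c \<in> relations T0 T1 \<Longrightarrow> - c \<in> relations T0 T1"
  using relations.diff[OF relations.zero] by fastforce

lemma relations_add: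
  "c \<in> relations T0 T1 \<Longrightarrow> d \<in> relations T0 T1 \<Longrightarrow> c + d \<in> relations T0 T1"
  using relations.diff[of c T0 T1 "- d"] relations_minus by fastforce

lemma cob_class_eqI:
  assumes "c - d \<in> relations T0 T1"
  shows "cob_class T0 T1 c = cob_class T0 T1 d"
proof -
  have "e - c \<in> relations T0 T1 \<longleftrightarrow> e - d \<in> relations T0 T1" for e
    using relations_add[of "e - c" T0 T1 "c - d"] relations.diff[of "e - d" T0 T1 "c - d"] assms
    by auto
  then show ?thesis by (simp add: cob_class_def)
qed

section \<open>Linearity of composition and the two crossing changes\<close>

lemma chain_comp_zero [simp]: "g \<odot> 0 = 0" "0 \<odot> f = 0"
proof -
  have "frag_extend (\<lambda>S. 0) g = 0" for g :: chain
    by (rule frag_extend_eq_0) auto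
  then show "g \<odot> 0 = 0" "0 \<odot> f = 0" by (auto simp: chain_comp_def)
qed

lemma chain_comp_of [simp]: "frag_of S' \<odot> frag_of S = frag_of (stack S S')"
  by (simp add: chain_comp_def)

lemma chain_comp_diff_left [simp]: "(g - g') \<odot> f = g \<odot> f - g' \<odot> f"
  by (simp add: chain_comp_def frag_extend_diff)

lemma chain_comp_minus_left [simp]: "(- g) \<odot> f = - (g \<odot> f)"
  by (simp add: chain_comp_def frag_extend_minus)

lemma chain_comp_minus_right [simp]: "g \<odot> (- f) = - (g \<odot> f)"
proof -
  have "frag_cmul n (- c) = - frag_cmul n c" for n and c :: chain
    by (simp add: poly_mapping_eqI)
  then have "frag_extend (\<lambda>S'. - b S') g = - frag_extend b g" for b :: "surface \<Rightarrow> chain"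
    by (simp add: frag_extend_def sum_negf del: minus_frag_cmul)
  then show ?thesis
    by (simp add: chain_comp_def frag_extend_minus)
qed

lemma frag_of_comp_diff [simp]: "frag_of S \<odot> (f - f') = frag_of S \<odot> f - frag_of S \<odot> f'"
  by (simp add: chain_comp_def frag_extend_diff)

lemma at_crossing_Phi_VVV:
  assumes "corner X k = (i, j)"
  shows "at_crossing X k VVV Phi =
    frag_of (surface_with i j tubed_sheets) - frag_of (surface_with i j handled_sheets)"
  by (simp add: at_crossing_def Phi_def frag_extend_diff
      insert_surface_VVV[OF localized_tubed_sheets assms]
      insert_surface_VVV[OF localized_handled_sheets assms])

lemma Phi_a_Phi_b:
  "at_crossing R Ca VVV Phi \<odot> iso (tangle L VVV) (tangle R VVV) \<odot> at_crossing L Ca VVV Phi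
   - at_crossing R Cb VVV Phi \<odot> iso (tangle L VVV) (tangle R VVV) \<odot> at_crossing L Cb VVV Phi
   \<in> relations T0 T1" (is "?a - ?b \<in> _")
proof -
  \<comment> \<open>The crossings \<open>Ca\<close> and \<open>Cb\<close> have first corner
    coordinate 1 in \<open>L\<close> and 2 in \<open>R\<close>; their heights are 5 for
    \<open>Ca\<close> and 1 for \<open>Cb\<close>.\<close>
  define \<sigma> where "\<sigma> j W W' =
    frag_of (stack (stack (surface_with 1 j W) (product_surface ({1, 2, 3} \<times> {0..7})))
      (surface_with 2 j W'))" for j W W'
  let ?t = tubed_sheets and ?h = handled_sheets
  define rel where "rel W W' = \<sigma> 5 W W' - \<sigma> 1 W W'" for W W'
  have rel: "rel W W' \<in> relations T0 T1" for W W'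
    unfolding rel_def \<sigma>_def by (intro relations.isotopy isotopic_stack)
  \<comment> \<open>Expanding both factors \<open>Phi\<close> as tube minus handle gives four pairs
    of surfaces, each related by the slide.\<close>
  have "?a - ?b = (rel ?t ?t - rel ?t ?h) - (rel ?h ?t - rel ?h ?h)"
    by (simp add: at_crossing_Phi_VVV iso_def isotopy_cobordism_def tangle_VVV
        rel_def \<sigma>_def)
  then show ?thesis by (simp add: rel relations.diff)
qed

section \<open>The component \<open>VVV \<rightarrow> VVV\<close>\<close>

declare bracket.simps [simp del]

lemma UNIV_smoothing: "UNIV = {V, H}"
  using smoothing.exhaust by auto

text \<open>Sums over infinite sets are 0 by convention, so finiteness is what lets the sums over
  intermediate states collapse.\<close>

lemma finite_state_set [simp]: "finite (S :: state set)"
proof -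
  have "finite (UNIV :: crossing set)" "finite (UNIV :: smoothing set)"
    by (simp_all add: UNIV_crossing UNIV_smoothing)
  then have "finite (UNIV :: state set)"
    using finite_UNIV_fun by blast
  then show ?thesis by (rule rev_finite_subset) simp
qed

text \<open>The smoothing \<open>V\<close> has local degree 0 at crossings of either sign.\<close>

lemma summands_crossing_change:
  assumes "e k = Neg" "s k = V"
  shows "s \<in> summands \<lbrakk>(X, e(k := Pos))\<rbrakk> i \<longleftrightarrow> s \<in> summands \<lbrakk>(X, e)\<rbrakk> i"
  using assms by (cases k) (auto simp: bracket.simps all_crossing)

text \<open>A crossing change is diagonal in the states, so each matrix product has at most one
  nonzero term. The membership assumptions ensure that this term occurs in the sum.\<close>

lemma component_Phi_hat_comp:
  assumes f: "tgt f = \<lbrakk>(Y, e')\<rbrakk>"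
    and k: "e k = Neg" "e' k = Neg"
    and s: "s \<in> summands \<lbrakk>(X, e)\<rbrakk> i" and u: "u \<in> summands \<lbrakk>(Y, e'(k := Pos))\<rbrakk> (i + hdeg f)"
  shows "component (Phi_hat k (Y, e') \<circledcirc> f \<circledcirc> Phi_hat k (X, e)) i s u =
    (if s k = V \<and> u k = V
     then at_crossing Y k u Phi \<odot> component f i s u \<odot> at_crossing X k s Phi else 0)"
proof -
  define g where "g = f \<circledcirc> Phi_hat k (X, e)"
  have g: "tgt g = \<lbrakk>(Y, e')\<rbrakk>" "hdeg g = hdeg f"
    by (simp_all add: g_def graded_comp_def f)
  have g_comp: "component g i s t =
      (if s k = V then component f i s t \<odot> at_crossing X k s Phi else 0)" for t
  proof (cases "s k = V")
    case True
    then have "s \<in> summands \<lbrakk>(X, e(k := Pos))\<rbrakk> i"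
      using s k summands_crossing_change by simp
    with True show ?thesis
      by (simp add: g_def graded_comp_def if_distrib[of "(\<odot>) _"] sum.delta cong: if_cong)
  qed (simp add: g_def graded_comp_def)
  have "component (Phi_hat k (Y, e') \<circledcirc> g) i s u = (\<Sum>t\<in>summands \<lbrakk>(Y, e')\<rbrakk> (i + hdeg f).
      (if t k = V \<and> u = t then at_crossing Y k t Phi else 0) \<odot> component g i s t)"
    by (simp add: graded_comp_def g)
  also have "\<dots> = (\<Sum>t\<in>summands \<lbrakk>(Y, e')\<rbrakk> (i + hdeg f). if u = t
         then (if u k = V then at_crossing Y k u Phi else 0) \<odot> component g i s u else 0)"
    by (intro sum.cong) auto
  also have "\<dots> = (if u k = V then at_crossing Y k u Phi \<odot> component g i s u else 0)"
    using u k summands_crossing_change[of e' k u Y "i + hdeg f"]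
    by (auto simp: sum.delta')
  finally show ?thesis by (simp add: g_comp flip: g_def del: Phi_hat.simps)
qed

lemma triple_simps [simp]: "triple x y z Ca = x" "triple x y z Cb = y" "triple x y z Cc = z"
  by (simp_all add: triple_def)

lemma triple_update [simp]:
  "(triple x y z)(Ca := w) = triple w y z" "(triple x y z)(Cb := w) = triple x w z"
  by (auto simp: fun_eq_iff triple_def split: crossing.split)

lemma triple_eq_iff [simp]: "triple x y z = triple x' y' z' \<longleftrightarrow> x = x' \<and> y = y' \<and> z = z'"
  by (auto simp: fun_eq_iff all_crossing)

lemma triple_collapse: "triple (s Ca) (s Cb) (s Cc) = s"
  by (simp add: fun_eq_iff all_crossing)

text \<open>Common form of the three hexagons, with \<open>c\<close> the single possible entry
  \<open>VVV \<rightarrow> VVV\<close>. The entries \<open>z\<close> and \<open>z'\<close> are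
  separate because \<open>psi_O\<close> and \<open>psi_U\<close> change the sign of the crossing
  \<open>c\<close>.\<close>

lemma crossing_changes_commute:
  assumes tgt: "tgt f = \<lbrakk>diagram R Neg Pos z'\<rbrakk>" "tgt g = \<lbrakk>diagram R Pos Neg z'\<rbrakk>"
    and hdeg: "hdeg g = hdeg f"
    and c: "c \<in> {0, iso (tangle L VVV) (tangle R VVV), - iso (tangle L VVV) (tangle R VVV)}"
    and f: "\<And>i y z y' z'. component f i (triple V y z) (triple V y' z') =
      (if i = 0 \<and> y = V \<and> z = V \<and> y' = V \<and> z' = V then c else 0)"
    and g: "\<And>i x z x' z'. component g i (triple x V z) (triple x' V z') =
      (if i = 0 \<and> x = V \<and> z = V \<and> x' = V \<and> z' = V then c else 0)"
  shows "Phi_hat Ca (diagram R Neg Pos z') \<circledcirc> f \<circledcirc> Phi_hat Ca (diagram L Neg Neg z) \<doteq>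
    Phi_hat Cb (diagram R Pos Neg z') \<circledcirc> g \<circledcirc> Phi_hat Cb (diagram L Neg Neg z)" (is "?f \<doteq> ?g")
proof -
  have src_tgt: "src ?f = \<lbrakk>diagram L Neg Neg z\<rbrakk>" "src ?g = src ?f"
      "tgt ?f = \<lbrakk>diagram R Pos Pos z'\<rbrakk>" "tgt ?g = tgt ?f" "hdeg ?f = hdeg f" "hdeg ?g = hdeg f"
    by (simp_all add: graded_comp_def diagram_def hdeg)
  have "cob_class T0 T1 (component ?f i s u) = cob_class T0 T1 (component ?g i s u)"
    if s: "s \<in> summands \<lbrakk>diagram L Neg Neg z\<rbrakk> i"
      and u: "u \<in> summands \<lbrakk>diagram R Pos Pos z'\<rbrakk> (i + hdeg f)" for T0 T1 i s u
  proof -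
    have f': "component f i s u = (if i = 0 \<and> s = VVV \<and> u = VVV then c else 0)"
      if V: "s Ca = V" "u Ca = V"
    proof -
      obtain y z y' z' where "s = triple V y z" "u = triple V y' z'"
        using V triple_collapse by metis
      then show ?thesis by (simp add: f)
    qed
    have g': "component g i s u = (if i = 0 \<and> s = VVV \<and> u = VVV then c else 0)"
      if V: "s Cb = V" "u Cb = V"
    proof -
      obtain x z x' z' where "s = triple x V z" "u = triple x' V z'"
        using V triple_collapse by metis
      then show ?thesis by (simp add: g)
    qed
    define a where "a = at_crossing R Ca VVV Phi \<odot> c \<odot> at_crossing L Ca VVV Phi"
    define b where "b = at_crossing R Cb VVV Phi \<odot> c \<odot> at_crossing L Cb VVV Phi"
    have "component ?f i s u = (if i = 0 \<and> s = VVV \<and> u = VVV then a else 0)"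
      using s u tgt unfolding diagram_def
      by (subst component_Phi_hat_comp) (auto simp: f f' a_def)
    moreover have "component ?g i s u = (if i = 0 \<and> s = VVV \<and> u = VVV then b else 0)"
      using s u tgt hdeg unfolding diagram_def
      by (subst component_Phi_hat_comp) (auto simp: g g' b_def)
    \<comment> \<open>For \<open>c = 0\<close> the difference vanishes; otherwise it is the relation
      \<open>Phi_a_Phi_b\<close> or its negative.\<close>
    moreover have "a - b \<in> relations T0 T1"
      using c Phi_a_Phi_b[of T0 T1] relations_minus[OF Phi_a_Phi_b[of T0 T1]]
      by (auto simp: a_def b_def relations.zero)
    ultimately show ?thesis using cob_class_eqI[of a b T0 T1] by presburger
  qed
  then show ?thesis by (simp add: graded_eq_def src_tgt)
qed

lemma graded_diff_eq_zero:
  assumes "f \<doteq> g"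
  shows "f \<ominus> g \<doteq> graded_zero (src f) (tgt f) (hdeg f)"
proof -
  have "cob_class T0 T1 (c - d) = cob_class T0 T1 0"
    if "cob_class T0 T1 c = cob_class T0 T1 d" for T0 T1 c d
  proof -
    \<comment> \<open>Equal cosets share the representative \<open>c\<close>, which turns the
      equality into membership of \<open>c - d\<close>.\<close>
    have "c \<in> cob_class T0 T1 c" by (simp add: cob_class_def relations.zero)
    then have "c - d \<in> relations T0 T1" unfolding that by (simp add: cob_class_def)
    then show ?thesis by (intro cob_class_eqI) simp
  qed
  with assms show ?thesis
    unfolding graded_eq_def graded_diff_def graded_zero_def by simp metis
qed

section \<open>Entries surviving the crossing changes\<close>

lemmas building_blocks = omega_O_def omega_U_def gamma_O_def gamma_U_def
  F_O_minus_def F_U_minus_def F_O_plus_def F_U_plus_def G_O_def G_U_def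
  Psi_O_minus_def Psi_U_minus_def Psi_O_plus_def Psi_U_plus_def

text \<open>Every listed block other than \<open>VVV \<rightarrow> VVV\<close> has \<open>a\<close>
  smoothed as \<open>H\<close> at its source or target. The minus sign is that of
  \<open>omega\<close> in the matrix.\<close>

lemma component_R_O_minus:
  "component R_O_minus i (triple V y z) (triple V y' z') =
    (if i = 0 \<and> y = V \<and> z = V \<and> y' = V \<and> z' = V then - iso (tangle L VVV) (tangle R VVV) else 0)"
  by (cases y; cases z; cases y'; cases z')
    (simp_all add: R_O_minus_def R_minus_matrix_def building_blocks)

lemma component_R_U_minus:
  "component R_U_minus i (triple x V z) (triple x' V z') =
    (if i = 0 \<and> x = V \<and> z = V \<and> x' = V \<and> z' = V then - iso (tangle L VVV) (tangle R VVV) else 0)"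
  by (cases x; cases z; cases x'; cases z')
    (simp_all add: R_U_minus_def R_minus_matrix_def building_blocks)

lemma component_R_O_plus:
  "component R_O_plus i (triple V y z) (triple V y' z') =
    (if i = 0 \<and> y = V \<and> z = V \<and> y' = V \<and> z' = V then iso (tangle L VVV) (tangle R VVV) else 0)"
  by (cases y; cases z; cases y'; cases z')
    (simp_all add: R_O_plus_def R_plus_matrix_def building_blocks)

lemma component_R_U_plus:
  "component R_U_plus i (triple x V z) (triple x' V z') =
    (if i = 0 \<and> x = V \<and> z = V \<and> x' = V \<and> z' = V then iso (tangle L VVV) (tangle R VVV) else 0)"
  by (cases x; cases z; cases x'; cases z')
    (simp_all add: R_U_plus_def R_plus_matrix_def building_blocks)

text \<open>Each block of \<open>G_O\<close>, \<open>Psi_O_minus\<close> and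
  \<open>Psi_O_plus\<close> has \<open>a\<close> smoothed as \<open>H\<close> at one end; in the
  U-case \<open>b\<close> has this role.\<close>

lemma component_psi_O:
  "component psi_O i (triple V y z) (triple V y' z') = 0"
  by (cases y; cases z; cases y'; cases z')
    (simp_all add: psi_O_def psi_matrix_def building_blocks)

lemma component_psi_U:
  "component psi_U i (triple x V z) (triple x' V z') = 0"
  by (cases x; cases z; cases x'; cases z')
    (simp_all add: psi_U_def psi_matrix_def building_blocks)

section \<open>The three hexagons\<close>

lemma hexagon_minus:
  "Phi_hat Ca (diagram R Neg Pos Neg) \<circledcirc> R_O_minus \<circledcirc> Phi_hat Ca (diagram L Neg Neg Neg)
   \<doteq> Phi_hat Cb (diagram R Pos Neg Neg) \<circledcirc> R_U_minus \<circledcirc> Phi_hat Cb (diagram L Neg Neg Neg)"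
  by (rule crossing_changes_commute[where c = "- iso (tangle L VVV) (tangle R VVV)"],
      simp_all add: component_R_O_minus component_R_U_minus)
    (simp_all add: R_O_minus_def R_U_minus_def)

lemma hexagon_plus:
  "Phi_hat Ca (diagram R Neg Pos Pos) \<circledcirc> R_O_plus \<circledcirc> Phi_hat Ca (diagram L Neg Neg Pos)
   \<doteq> Phi_hat Cb (diagram R Pos Neg Pos) \<circledcirc> R_U_plus \<circledcirc> Phi_hat Cb (diagram L Neg Neg Pos)"
  by (rule crossing_changes_commute[where c = "iso (tangle L VVV) (tangle R VVV)"],
      simp_all add: component_R_O_plus component_R_U_plus)
    (simp_all add: R_O_plus_def R_U_plus_def)

lemma psi_hexagon:
  "Phi_hat Ca (diagram R Neg Pos Pos) \<circledcirc> psi_O \<circledcirc> Phi_hat Ca (diagram L Neg Neg Neg)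
   \<doteq> Phi_hat Cb (diagram R Pos Neg Pos) \<circledcirc> psi_U \<circledcirc> Phi_hat Cb (diagram L Neg Neg Neg)"
  by (rule crossing_changes_commute[where c = 0],
      simp_all add: component_psi_O component_psi_U)
    (simp_all add: psi_O_def psi_U_def)

theorem theorem1:
  shows "(Phi_hat Ca (diagram R Neg Pos Neg) \<circledcirc> R_O_minus \<circledcirc> Phi_hat Ca (diagram L Neg Neg Neg)
            \<doteq> Phi_hat Cb (diagram R Pos Neg Neg) \<circledcirc> R_U_minus \<circledcirc> Phi_hat Cb (diagram L Neg Neg Neg))
       \<and> (Phi_hat Ca (diagram R Neg Pos Pos) \<circledcirc> R_O_plus \<circledcirc> Phi_hat Ca (diagram L Neg Neg Pos)
            \<doteq> Phi_hat Cb (diagram R Pos Neg Pos) \<circledcirc> R_U_plus \<circledcirc> Phi_hat Cb (diagram L Neg Neg Pos))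
       \<and> ((Phi_hat Ca (diagram R Neg Pos Pos) \<circledcirc> psi_O \<circledcirc> Phi_hat Ca (diagram L Neg Neg Neg))
            \<ominus> (Phi_hat Cb (diagram R Pos Neg Pos) \<circledcirc> psi_U \<circledcirc> Phi_hat Cb (diagram L Neg Neg Neg))
            \<doteq> graded_zero \<lbrakk>diagram L Neg Neg Neg\<rbrakk> \<lbrakk>diagram R Pos Pos Pos\<rbrakk> (-1))"
proof (intro conjI hexagon_minus hexagon_plus)
  let ?f = "Phi_hat Ca (diagram R Neg Pos Pos) \<circledcirc> psi_O \<circledcirc> Phi_hat Ca (diagram L Neg Neg Neg)"
  have "src ?f = \<lbrakk>diagram L Neg Neg Neg\<rbrakk>" "tgt ?f = \<lbrakk>diagram R Pos Pos Pos\<rbrakk>" "hdeg ?f = -1"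
    by (simp_all add: graded_comp_def diagram_def psi_O_def)
  then show "?f \<ominus> (Phi_hat Cb (diagram R Pos Neg Pos) \<circledcirc> psi_U \<circledcirc> Phi_hat Cb (diagram L Neg Neg Neg))
      \<doteq> graded_zero \<lbrakk>diagram L Neg Neg Neg\<rbrakk> \<lbrakk>diagram R Pos Pos Pos\<rbrakk> (-1)"
    using graded_diff_eq_zero[OF psi_hexagon] by simp
qed

end
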